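(* Let $\Phi=(G,\varphi)$ be a complex unit gain graph with $n\ge2$ vertices, with gain Laplacian $L(\Phi)$ and largest Laplacian eigenvalue $\lambda_n(\Phi)$. Then for every positive integer $k$, $$\lambda_n(\Phi)\ge\sqrt[k]{\frac{\operatorname{Tr}(L^{k}(\Phi))}{n}+\sqrt{\frac{1}{n^2(n-1)}\Bigl(n\operatorname{Tr}(L^{2k}(\Phi))-\operatorname{Tr}(L^k(\Phi))^2\Bigr)}},$$ and $$\lambda_n(\Phi)=\lim_{k\to\infty}\sqrt[k]{\frac{\operatorname{Tr}(L^{k}(\Phi))}{n}+\sqrt{\frac{1}{n^2(n-1)}\Bigl(n\operatorname{Tr}(L^{2k}(\Phi))-\operatorname{Tr}(L^k(\Phi))^2\Bigr)}}.$$
   Context: A complex unit gain graph ($\mathbb{T}$-gain graph) $\Phi=(G,\varphi)$ consists of a finite simple undirected graph $G$ with vertices $v_1,\dots,v_n$ and a map $\varphi$ assigning to each oriented edge $\overrightarrow{e}_{ij}$ (from $v_i$ to $v_j$, where $v_i\sim v_j$) a complex number of modulus $1$, with $\varphi(\overrightarrow{e}_{ji})=\varphi(\overrightarrow{e}_{ij})^{-1}$. Its adjacency matrix $\mathbf{A}(\Phi)=(a_{ij})$ has $a_{ij}=\varphi(\overrightarrow{e}_{ij})$ if $v_i\sim v_j$ and $a_{ij}=0$ otherwise. The gain Laplacian is $L(\Phi)=\mathbf{D}(G)-\mathbf{A}(\Phi)$, where $\mathbf{D}(G)$ is the diagonal matrix of vertex degrees of $G$; it is Hermitian positive semidefinite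 with eigenvalues $0\le\lambda_1(\Phi)\le\dots\le\lambda_n(\Phi)$. $\operatorname{Tr}$ denotes the trace, and $L^k(\Phi)$ is the $k$-th matrix power of $L(\Phi)$. *)

theory Defs
  imports
    "Jordan_Normal_Form.Spectral_Radius"
    "Graph_Theory.Pair_Digraph"
begin

text \<open>
  A finite simple undirected graph is a \<^locale>\<open>pair_graph\<close>: a finite, loop-free, symmetric set of
  arcs. Each undirected edge gives the two arcs \<open>(x, y)\<close> and \<open>(y, x)\<close>, which are its
  orientations, and \<open>\<phi>\<close> is the gain map on these. The values of \<open>\<phi>\<close> outside the arcs are irrelevant.
  The bijection \<open>v\<close> is the enumeration of the vertices, with indices starting at 0.
\<close>

locale unit_gain_graph = pair_graph G
  for G :: "'a pair_pre_digraph" +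
  fixes \<phi> :: "'a \<times> 'a \<Rightarrow> complex"
    and v :: "nat \<Rightarrow> 'a"
    and n :: nat
  assumes vertex_enum: "bij_betw v {..<n} (pverts G)"
    and gain_unit: "(x, y) \<in> parcs G \<Longrightarrow> cmod (\<phi> (x, y)) = 1"
    and gain_reverse: "(x, y) \<in> parcs G \<Longrightarrow> \<phi> (y, x) = inverse (\<phi> (x, y))"

definition gain_adjacency ::
  "'a pair_pre_digraph \<Rightarrow> ('a \<times> 'a \<Rightarrow> complex) \<Rightarrow> (nat \<Rightarrow> 'a) \<Rightarrow> nat \<Rightarrow> complex mat" where
  "gain_adjacency G \<phi> v n =
     mat n n (\<lambda>(i, j). if (v i, v j) \<in> parcs G then \<phi> (v i, v j) else 0)"

text \<open>In a symmetric digraph the out-degree of a vertex is its degree in the undirected graph.\<close>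

definition degree_matrix :: "'a pair_pre_digraph \<Rightarrow> (nat \<Rightarrow> 'a) \<Rightarrow> nat \<Rightarrow> complex mat" where
  "degree_matrix G v n =
     mat n n (\<lambda>(i, j). if i = j then of_nat (out_degree (with_proj G) (v i)) else 0)"

definition gain_laplacian ::
  "'a pair_pre_digraph \<Rightarrow> ('a \<times> 'a \<Rightarrow> complex) \<Rightarrow> (nat \<Rightarrow> 'a) \<Rightarrow> nat \<Rightarrow> complex mat" where
  "gain_laplacian G \<phi> v n = degree_matrix G v n - gain_adjacency G \<phi> v n"

definition mat_trace :: "'a :: comm_monoid_add mat \<Rightarrow> 'a" where
  "mat_trace A = (\<Sum>i<dim_row A. A $$ (i, i))"

text \<open>
  Largest eigenvalue of a matrix with real spectrum. For the gain Laplacian the maximum is over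
  all eigenvalues and exists; see the lemmas at the end.
\<close>

definition largest_eigenvalue :: "complex mat \<Rightarrow> real" where
  "largest_eigenvalue A = Max {x. eigenvalue A (complex_of_real x)}"

lemma gain_laplacian_carrier [simp]: "gain_laplacian G \<phi> v n \<in> carrier_mat n n"
  by (simp add: gain_laplacian_def degree_matrix_def gain_adjacency_def minus_carrier_mat)

context unit_gain_graph
begin

lemma gain_laplacian_hermitian:
  assumes "i < n" "j < n"
  shows "gain_laplacian G \<phi> v n $$ (j, i) = cnj (gain_laplacian G \<phi> v n $$ (i, j))"
proof -
  have sym: "(x, y) \<in> parcs G \<longleftrightarrow> (y, x) \<in> parcs G" for x y
    using pair_sym_arcs by (auto simp: symmetric_def sym_def)
  have gain: "\<phi> (y, x) = cnj (\<phi> (x, y))" if "(x, y) \<in> parcs G" for x y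
  proof -
    have "\<phi> (x, y) * cnj (\<phi> (x, y)) = 1"
      using gain_unit[OF that] by (simp flip: complex_norm_square)
    then show ?thesis
      using gain_reverse[OF that] by (simp add: inverse_unique)
  qed
  have "gain_adjacency G \<phi> v n $$ (j, i) = cnj (gain_adjacency G \<phi> v n $$ (i, j))"
    using assms sym[of "v i" "v j"] gain[of "v i" "v j"] by (simp add: gain_adjacency_def)
  moreover have "degree_matrix G v n $$ (j, i) = cnj (degree_matrix G v n $$ (i, j))"
    using assms by (simp add: degree_matrix_def)
  moreover have "gain_laplacian G \<phi> v n $$ (k, l)
      = degree_matrix G v n $$ (k, l) - gain_adjacency G \<phi> v n $$ (k, l)"
    if "k < n" "l < n" for k l
    using that by (simp add: gain_laplacian_def degree_matrix_def gain_adjacency_def)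
  ultimately show ?thesis using assms by simp
qed

lemma gain_laplacian_trace_power_real:
  "mat_trace (gain_laplacian G \<phi> v n ^\<^sub>m k) \<in> \<real>"
proof -
  let ?L = "gain_laplacian G \<phi> v n"
  have P: "?L ^\<^sub>m k \<in> carrier_mat n n" for k by (rule pow_carrier_mat) simp
  have L: "dim_row ?L = n" "dim_col ?L = n"
    using carrier_matD[OF gain_laplacian_carrier[of G \<phi> v n]] by simp_all
  have comm: "?L ^\<^sub>m k * ?L = ?L * ?L ^\<^sub>m k" for k
  proof (induction k)
    case (Suc k)
    have "?L ^\<^sub>m Suc k * ?L = (?L * ?L ^\<^sub>m k) * ?L" using Suc by simp
    also have "\<dots> = ?L * (?L ^\<^sub>m k * ?L)"
      using P by (intro assoc_mult_mat[of _ n n _ n _ n]) auto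
    finally show ?case by simp
  qed (use L in simp)
  have "(?L ^\<^sub>m k) $$ (j, i) = cnj ((?L ^\<^sub>m k) $$ (i, j))" if "i < n" "j < n" for i j
    using that
  proof (induction k arbitrary: i j)
    case 0
    then show ?case by (simp add: L)
  next
    case (Suc k)
    have D: "dim_row (?L ^\<^sub>m k) = n" "dim_col (?L ^\<^sub>m k) = n"
      using carrier_matD[OF P[of k]] by simp_all
    have "(?L ^\<^sub>m Suc k) $$ (j, i) = (?L * ?L ^\<^sub>m k) $$ (j, i)" by (simp add: comm)
    also have "\<dots> = (\<Sum>l = 0..<n. ?L $$ (j, l) * (?L ^\<^sub>m k) $$ (l, i))"
      using Suc.prems by (simp add: L D scalar_prod_def)
    also have "\<dots> = (\<Sum>l = 0..<n. cnj (?L $$ (l, j)) * cnj ((?L ^\<^sub>m k) $$ (i, l)))"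
    proof (rule sum.cong)
      fix l assume "l \<in> {0..<n}"
      then have l: "l < n" by simp
      show "?L $$ (j, l) * (?L ^\<^sub>m k) $$ (l, i)
          = cnj (?L $$ (l, j)) * cnj ((?L ^\<^sub>m k) $$ (i, l))"
        using gain_laplacian_hermitian[OF l Suc.prems(2)] Suc.IH[OF Suc.prems(1) l] by simp
    qed simp
    also have "\<dots> = cnj ((?L ^\<^sub>m Suc k) $$ (i, j))"
      using Suc.prems by (simp add: L D scalar_prod_def mult.commute)
    finally show ?case .
  qed
  then have "(?L ^\<^sub>m k) $$ (i, i) \<in> \<real>" if "i < n" for i
    using that by (metis Reals_cnj_iff)
  then show ?thesis
    using L by (auto simp: mat_trace_def)
qed

lemma gain_laplacian_eigenvalue_real:
  assumes "eigenvalue (gain_laplacian G \<phi> v n) c"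
  shows "c \<in> \<real>"
proof -
  let ?L = "gain_laplacian G \<phi> v n"
  have L: "dim_row ?L = n" "dim_col ?L = n"
    using carrier_matD[OF gain_laplacian_carrier[of G \<phi> v n]] by simp_all
  obtain w where w: "w \<in> carrier_vec n" "w \<noteq> 0\<^sub>v n" and ev: "?L *\<^sub>v w = c \<cdot>\<^sub>v w"
    using assms unfolding eigenvalue_def eigenvector_def L by blast
  define N where "N = (\<Sum>i<n. (cmod (w $ i))\<^sup>2)"
  define Q where "Q = (\<Sum>i<n. \<Sum>j<n. cnj (w $ i) * ?L $$ (i, j) * w $ j)"
  have row: "(\<Sum>j<n. ?L $$ (i, j) * w $ j) = c * w $ i" if "i < n" for i
  proof -
    have "(?L *\<^sub>v w) $ i = (\<Sum>j<n. ?L $$ (i, j) * w $ j)"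
      using that w L by (simp add: scalar_prod_def atLeast0LessThan)
    with ev that w show ?thesis by simp
  qed
  have "Q = (\<Sum>i<n. cnj (w $ i) * (c * w $ i))"
    unfolding Q_def
  proof (intro sum.cong refl)
    fix i assume "i \<in> {..<n}"
    then have "c * w $ i = (\<Sum>j<n. ?L $$ (i, j) * w $ j)" by (simp add: row)
    then show "(\<Sum>j<n. cnj (w $ i) * ?L $$ (i, j) * w $ j) = cnj (w $ i) * (c * w $ i)"
      by (simp only: sum_distrib_left mult.assoc)
  qed
  also have "\<dots> = c * of_real N"
    unfolding N_def of_real_sum sum_distrib_left
    by (intro sum.cong refl) (simp only: complex_norm_square mult_ac)
  finally have Q: "Q = c * of_real N" .
  have "cnj Q = (\<Sum>i<n. \<Sum>j<n. cnj (w $ j) * ?L $$ (j, i) * w $ i)"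
    unfolding Q_def cnj_sum
    by (intro sum.cong) (auto simp flip: gain_laplacian_hermitian)
  also have "\<dots> = Q"
    unfolding Q_def by (rule sum.swap)
  finally have "cnj Q = Q" .
  obtain i where "i < n" "w $ i \<noteq> 0"
    using w by (auto simp: vec_eq_iff)
  then have "N > 0"
    unfolding N_def by (intro sum_pos2[of _ i]) auto
  with Q \<open>cnj Q = Q\<close> have "cnj c = c" by simp
  then show ?thesis by (simp add: Reals_cnj_iff)
qed

lemma gain_laplacian_spectrum:
  assumes "n > 0"
  defines "S \<equiv> {x. eigenvalue (gain_laplacian G \<phi> v n) (complex_of_real x)}"
  shows "finite S" "S \<noteq> {}" "spectrum (gain_laplacian G \<phi> v n) = complex_of_real ` S"
proof -
  show spec: "spectrum (gain_laplacian G \<phi> v n) = complex_of_real ` S"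
    using gain_laplacian_eigenvalue_real by (force simp: S_def spectrum_def elim: Reals_cases)
  have "finite (complex_of_real ` S)"
    using card_finite_spectrum(1)[OF gain_laplacian_carrier[of G \<phi> v n]] by (simp only: spec)
  then show "finite S" by (rule finite_imageD) (simp add: inj_on_def)
  show "S \<noteq> {}"
    using spectrum_non_empty[OF gain_laplacian_carrier assms(1), of G \<phi> v] by (auto simp: spec)
qed

end

end

(*
  The bound is the Wolkowicz-Styan inequality max x >= mean x + s / sqrt (n - 1) for the numbers
  lambda_i^k, where s is their standard deviation; mean and deviation are read off from
  Tr L^k and Tr L^(2k) because a Schur triangulation of L shows that Tr L^k = sum lambda_i^k.
  Eigenvalues are nonnegative by Gershgorin's theorem, since every Laplacian row has diagonal
  entry equal to the absolute row sum off the diagonal. Dropping the square root leaves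
  lambda_n / n^(1/k) as a lower bound for the k-th root, and this tends to lambda_n.
*)
theory Submission
  imports Defs "HOL-Analysis.Convex"
begin

section \<open>Traces and powers of triangular matrices\<close>

lemma mat_trace_mult_commute:
  fixes A B :: "'a::comm_semiring_0 mat"
  assumes "A \<in> carrier_mat n m" "B \<in> carrier_mat m n"
  shows "mat_trace (A * B) = mat_trace (B * A)"
proof -
  have "mat_trace (A * B) = (\<Sum>i<n. \<Sum>j<m. A $$ (i, j) * B $$ (j, i))"
    using assms by (simp add: mat_trace_def scalar_prod_def atLeast0LessThan)
  also have "\<dots> = (\<Sum>j<m. \<Sum>i<n. B $$ (j, i) * A $$ (i, j))"
    by (subst sum.swap) (simp add: mult.commute)
  also have "\<dots> = mat_trace (B * A)"
    using assms by (simp add: mat_trace_def scalar_prod_def atLeast0LessThan)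
  finally show ?thesis .
qed

lemma mat_trace_similar:
  fixes A B :: "'a::comm_semiring_1 mat"
  assumes "similar_mat_wit A B P Q"
  shows "mat_trace A = mat_trace B"
proof -
  define n where "n = dim_row A"
  note w = similar_mat_witD[OF n_def assms]
  have "mat_trace A = mat_trace (Q * (P * B))"
    unfolding w(3) using w by (intro mat_trace_mult_commute[of _ n n]) auto
  also have "Q * (P * B) = B"
    using w by (simp flip: assoc_mult_mat[of Q n n P n B n])
  finally show ?thesis .
qed

text \<open>Both claims go through a single induction on \<open>k\<close>, because the diagonal
  formula for \<open>Suc k\<close> relies on the zeros below the diagonal of the \<open>k\<close>-th
  power.\<close>

lemma upper_triangular_pow:
  fixes B :: "'a::comm_semiring_1 mat"
  assumes B: "B \<in> carrier_mat n n" and ut: "upper_triangular B"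
  shows "upper_triangular (B ^\<^sub>m k)"
    and "\<And>i. i < n \<Longrightarrow> (B ^\<^sub>m k) $$ (i, i) = (B $$ (i, i)) ^ k"
proof -
  have P: "B ^\<^sub>m k \<in> carrier_mat n n" for k
    using B by (rule pow_carrier_mat)
  have "upper_triangular (B ^\<^sub>m k) \<and> (\<forall>i<n. (B ^\<^sub>m k) $$ (i, i) = (B $$ (i, i)) ^ k)"
  proof (induction k)
    case 0
    then show ?case using B by auto
  next
    case (Suc k)
    have entry: "(B ^\<^sub>m Suc k) $$ (i, j) = (\<Sum>l<n. (B ^\<^sub>m k) $$ (i, l) * B $$ (l, j))"
      if "i < n" "j < n" for i j
      using that P[of k] B by (simp add: scalar_prod_def atLeast0LessThan)
    have zero: "(B ^\<^sub>m k) $$ (i, l) = 0" if "l < i" "i < n" for i l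
      using Suc P[of k] that by auto
    have zeroB: "B $$ (i, l) = 0" if "l < i" "i < n" for i l
      using ut B that by auto
    have "(B ^\<^sub>m Suc k) $$ (i, j) = 0" if "j < i" "i < n" for i j
    proof -
      \<comment> \<open>An index \<open>l\<close> below \<open>i\<close> makes the first factor
        vanish; any other \<open>l\<close> exceeds \<open>j\<close> and makes the second one
        vanish.\<close>
      have "(B ^\<^sub>m k) $$ (i, l) * B $$ (l, j) = 0" if "l < n" for l
        using zero[of l i] zeroB[of j l] that \<open>j < i\<close> \<open>i < n\<close> by (cases "l < i") auto
      then show ?thesis using that by (simp only: entry) (simp add: sum.neutral)
    qed
    moreover have "(B ^\<^sub>m Suc k) $$ (i, i) = (B $$ (i, i)) ^ Suc k" if "i < n" for i
    proof -
      have "(B ^\<^sub>m k) $$ (i, l) * B $$ (l, i) = (if l = i then (B $$ (i, i)) ^ Suc k else 0)"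
        if "l < n" for l
        using zero[of l i] zeroB[of i l] that \<open>i < n\<close> Suc
        by (cases l i rule: linorder_cases) (auto simp: mult.commute)
      then show ?thesis using that by (simp only: entry) simp
    qed
    ultimately show ?case
      by (intro conjI upper_triangularI allI impI) (simp_all only: carrier_matD[OF P])
  qed
  then show "upper_triangular (B ^\<^sub>m k)"
    and "\<And>i. i < n \<Longrightarrow> (B ^\<^sub>m k) $$ (i, i) = (B $$ (i, i)) ^ k" by auto
qed

text \<open>The numbers \<open>d i\<close> are the diagonal of one Schur form \<open>B\<close>, that
  is, the eigenvalues with algebraic multiplicity. The same \<open>d\<close> serves all
  \<open>k\<close>, since the similarity of \<open>A\<close> and \<open>B\<close> passes to their
  powers.\<close>

lemma mat_trace_pow_eigenvalues:
  fixes A :: "complex mat"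
  assumes A: "A \<in> carrier_mat n n"
  obtains d where "spectrum A = d ` {..<n}"
    and "\<And>k. mat_trace (A ^\<^sub>m k) = (\<Sum>i<n. d i ^ k)"
proof -
  obtain es where "char_poly A = (\<Prod>a\<leftarrow>es. [:- a, 1:])"
    using char_poly_factorized[OF A] by blast
  from schur_decomposition_exists[OF A this] obtain B P Q
    where B: "B \<in> carrier_mat n n" and ut: "upper_triangular B"
      and sim: "similar_mat_wit A B P Q"
    unfolding similar_mat_def by blast
  define d where "d i = B $$ (i, i)" for i
  have "char_poly A = char_poly B"
    using sim by (intro char_poly_similar) (auto simp: similar_mat_def)
  then have cp: "char_poly A = (\<Prod>a\<leftarrow>diag_mat B. [:- a, 1:])"
    using char_poly_upper_triangular[OF B ut] by simp
  have "spectrum A = set (diag_mat B)"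
    unfolding spectrum_def eigenvalue_root_char_poly[OF A] cp
    by (auto simp: poly_prod_list prod_list_zero_iff)
  then have "spectrum A = d ` {..<n}"
    using B by (auto simp: diag_mat_def d_def)
  moreover have "mat_trace (A ^\<^sub>m k) = (\<Sum>i<n. d i ^ k)" for k
  proof -
    have "mat_trace (A ^\<^sub>m k) = mat_trace (B ^\<^sub>m k)"
      by (rule mat_trace_similar[OF similar_mat_wit_pow[OF sim]])
    also have "\<dots> = (\<Sum>i<n. d i ^ k)"
      using upper_triangular_pow(2)[OF B ut] B
      by (simp add: mat_trace_def d_def carrier_matD[OF pow_carrier_mat[OF B]])
    finally show ?thesis .
  qed
  ultimately show thesis using that by blast
qed

section \<open>Localisation of eigenvalues\<close>

text \<open>The row \<open>i\<close> is one where the eigenvector has an entry of largest modulus.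
  In that row of the eigenvalue equation every off-diagonal term is controlled by this modulus,
  which is positive and cancels.\<close>

lemma gershgorin_disc:
  fixes A :: "complex mat"
  assumes A: "A \<in> carrier_mat n n" and ev: "eigenvalue A c"
  obtains i where "i < n" "cmod (c - A $$ (i, i)) \<le> (\<Sum>j\<in>{..<n} - {i}. cmod (A $$ (i, j)))"
proof -
  obtain w where w: "w \<in> carrier_vec n" "w \<noteq> 0\<^sub>v n" and eq: "A *\<^sub>v w = c \<cdot>\<^sub>v w"
    using ev A unfolding eigenvalue_def eigenvector_def by auto
  obtain i0 where i0: "i0 < n" "w $ i0 \<noteq> 0"
    using w by (auto simp: vec_eq_iff)
  define M where "M = Max ((\<lambda>i. cmod (w $ i)) ` {..<n})"
  have "M \<in> (\<lambda>i. cmod (w $ i)) ` {..<n}"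
    unfolding M_def using i0 by (intro Max_in) auto
  then obtain i where i: "i < n" "M = cmod (w $ i)" by auto
  have le: "cmod (w $ j) \<le> cmod (w $ i)" if "j < n" for j
    unfolding i(2)[symmetric] M_def using that by (intro Max_ge) auto
  have pos: "cmod (w $ i) > 0"
    using le[OF i0(1)] i0(2) by (meson less_le_trans zero_less_norm_iff)
  have "c * w $ i = (A *\<^sub>v w) $ i"
    using eq i w by simp
  also have "\<dots> = (\<Sum>j<n. A $$ (i, j) * w $ j)"
    using i w A by (simp add: scalar_prod_def atLeast0LessThan)
  also have "\<dots> = A $$ (i, i) * w $ i + (\<Sum>j\<in>{..<n} - {i}. A $$ (i, j) * w $ j)"
    using i by (simp add: sum.remove)
  finally have "(c - A $$ (i, i)) * w $ i = (\<Sum>j\<in>{..<n} - {i}. A $$ (i, j) * w $ j)"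
    by (simp add: algebra_simps)
  then have "cmod (c - A $$ (i, i)) * cmod (w $ i)
      = cmod (\<Sum>j\<in>{..<n} - {i}. A $$ (i, j) * w $ j)"
    by (metis norm_mult)
  also have "\<dots> \<le> (\<Sum>j\<in>{..<n} - {i}. cmod (A $$ (i, j)) * cmod (w $ i))"
    by (intro sum_norm_le) (auto simp: norm_mult intro!: mult_left_mono le)
  also have "\<dots> = (\<Sum>j\<in>{..<n} - {i}. cmod (A $$ (i, j))) * cmod (w $ i)"
    by (simp add: sum_distrib_right)
  finally show thesis
    using that[OF i(1)] pos by simp
qed

section \<open>Spectrum of the gain Laplacian\<close>

context unit_gain_graph
begin

lemma out_degree_eq_card_indices:
  assumes "i < n"
  shows "out_degree (with_proj G) (v i) = card {j \<in> {..<n}. (v i, v j) \<in> parcs G}"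
proof -
  have "out_arcs (with_proj G) (v i) = (\<lambda>j. (v i, v j)) ` {j \<in> {..<n}. (v i, v j) \<in> parcs G}"
  proof -
    have "y \<in> v ` {..<n}" if "(v i, y) \<in> parcs G" for y
      using vertex_enum arc_snd_in_verts[OF that] by (simp add: bij_betw_def)
    then show ?thesis by (fastforce simp: out_arcs_def)
  qed
  moreover have "inj_on (\<lambda>j. (v i, v j)) {j \<in> {..<n}. (v i, v j) \<in> parcs G}"
    using vertex_enum by (auto simp: bij_betw_def inj_on_def)
  ultimately show ?thesis by (simp add: out_degree_def card_image)
qed

text \<open>Gains have modulus 1, so the off-diagonal moduli in a row just count the neighbours of
  the vertex.\<close>

lemma gain_laplacian_diag_eq_row_sum:
  assumes "i < n"
  shows "gain_laplacian G \<phi> v n $$ (i, i)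
    = of_real (\<Sum>j\<in>{..<n} - {i}. cmod (gain_laplacian G \<phi> v n $$ (i, j)))"
proof -
  have noloop: "(v i, v i) \<notin> parcs G"
    using no_loops[of "(v i, v i)"] by auto
  have "(\<Sum>j\<in>{..<n} - {i}. cmod (gain_laplacian G \<phi> v n $$ (i, j)))
      = (\<Sum>j\<in>{..<n} - {i}. if (v i, v j) \<in> parcs G then 1 else 0)"
    using assms gain_unit
    by (intro sum.cong) (auto simp: gain_laplacian_def degree_matrix_def gain_adjacency_def)
  \<comment> \<open>The index \<open>i\<close> may be added back because there is no loop at
    \<open>v i\<close>.\<close>
  also have "\<dots> = (\<Sum>j<n. if (v i, v j) \<in> parcs G then 1 else 0)"
    using noloop by (intro sum.mono_neutral_left) auto
  also have "\<dots> = real (out_degree (with_proj G) (v i))"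
    using assms by (simp add: out_degree_eq_card_indices flip: sum.inter_filter)
  finally show ?thesis
    using assms noloop by (simp add: gain_laplacian_def degree_matrix_def gain_adjacency_def)
qed

text \<open>Each Gershgorin disc has its radius \<open>r\<close> equal to its centre, so it meets
  the real line in the interval from 0 to 2\<open>r\<close>.\<close>

lemma gain_laplacian_eigenvalue_nonneg:
  assumes "eigenvalue (gain_laplacian G \<phi> v n) (complex_of_real x)"
  shows "x \<ge> 0"
proof -
  let ?L = "gain_laplacian G \<phi> v n"
  obtain i where i: "i < n"
    and disc: "cmod (of_real x - ?L $$ (i, i)) \<le> (\<Sum>j\<in>{..<n} - {i}. cmod (?L $$ (i, j)))"
    using gershgorin_disc[OF gain_laplacian_carrier assms] .
  define r where "r = (\<Sum>j\<in>{..<n} - {i}. cmod (?L $$ (i, j)))"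
  have "cmod (of_real x - of_real r) \<le> r"
    using disc unfolding gain_laplacian_diag_eq_row_sum[OF i] r_def .
  then have "\<bar>x - r\<bar> \<le> r"
    by (simp flip: of_real_diff)
  then show ?thesis by simp
qed

text \<open>Passes from complex to real numbers: each diagonal entry of the Schur form is an
  eigenvalue, hence real, and so equals its real part.\<close>

lemma gain_laplacian_real_eigenvalues:
  obtains d :: "nat \<Rightarrow> real"
  where "{x. eigenvalue (gain_laplacian G \<phi> v n) (complex_of_real x)} = d ` {..<n}"
    and "\<And>k. Re (mat_trace (gain_laplacian G \<phi> v n ^\<^sub>m k)) = (\<Sum>i<n. d i ^ k)"
proof -
  let ?L = "gain_laplacian G \<phi> v n"
  obtain e where spec: "spectrum ?L = e ` {..<n}"
    and tr: "\<And>k. mat_trace (?L ^\<^sub>m k) = (\<Sum>i<n. e i ^ k)"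
    using mat_trace_pow_eigenvalues[OF gain_laplacian_carrier] by metis
  define d where "d i = Re (e i)" for i
  have e: "e i = of_real (d i)" if "i < n" for i
  proof -
    have "eigenvalue ?L (e i)"
      using spec that by (auto simp: spectrum_def)
    then show ?thesis
      using gain_laplacian_eigenvalue_real by (simp add: d_def)
  qed
  have "eigenvalue ?L (of_real x) \<longleftrightarrow> complex_of_real x \<in> e ` {..<n}" for x
    using spec by (auto simp: spectrum_def)
  moreover have "complex_of_real x \<in> e ` {..<n} \<longleftrightarrow> x \<in> d ` {..<n}" for x
    using e by (auto simp: image_iff)
  moreover have "Re (mat_trace (?L ^\<^sub>m k)) = (\<Sum>i<n. d i ^ k)" for k
    unfolding tr by (simp add: e flip: of_real_power)
  ultimately show thesis using that by auto
qed

end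

section \<open>A variance inequality and a limit of roots\<close>

text \<open>The gaps \<open>M - x i\<close> are nonnegative, so the sum of their squares is at most
  the square of their sum \<open>D\<close>. Expanded, this bounds the variance by a multiple of
  \<open>D\<close> squared, and \<open>D / n\<close> is the distance from the mean to
  \<open>M\<close>.\<close>

lemma wolkowicz_styan:
  fixes x :: "nat \<Rightarrow> real"
  assumes n: "n \<ge> 2" and le: "\<And>i. i < n \<Longrightarrow> x i \<le> M"
  shows "(\<Sum>i<n. x i) / real n
    + sqrt (1 / ((real n)\<^sup>2 * (real n - 1)) * (real n * (\<Sum>i<n. (x i)\<^sup>2) - (\<Sum>i<n. x i)\<^sup>2)) \<le> M"
proof -
  define S where "S = (\<Sum>i<n. x i)"
  define D where "D = real n * M - S"
  have D: "D = (\<Sum>i<n. M - x i)"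
    by (simp add: D_def S_def sum_subtractf)
  have D0: "D \<ge> 0"
    unfolding D using le by (intro sum_nonneg) simp
  \<comment> \<open>One factor of each square is replaced by \<open>D\<close>, a sum of nonnegative
    terms that includes it.\<close>
  have "(\<Sum>i<n. (M - x i)\<^sup>2) \<le> (\<Sum>i<n. (M - x i) * D)"
    unfolding power2_eq_square D using le
    by (intro sum_mono mult_left_mono member_le_sum) auto
  also have "\<dots> = D\<^sup>2"
    by (simp add: D power2_eq_square flip: sum_distrib_right)
  finally have "(\<Sum>i<n. (M - x i)\<^sup>2) \<le> D\<^sup>2" .
  moreover have "(\<Sum>i<n. (M - x i)\<^sup>2) = real n * M\<^sup>2 - 2 * M * S + (\<Sum>i<n. (x i)\<^sup>2)"
    by (simp add: S_def power2_diff sum.distrib sum_subtractf sum_distrib_left)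
  ultimately have "real n * (real n * M\<^sup>2 - 2 * M * S + (\<Sum>i<n. (x i)\<^sup>2)) \<le> real n * D\<^sup>2"
    by (intro mult_left_mono) auto
  \<comment> \<open>The terms in \<open>M\<close> drop out because
    \<open>n * (n * M^2 - 2 * M * S) = D^2 - S^2\<close>.\<close>
  then have "real n * (\<Sum>i<n. (x i)\<^sup>2) - S\<^sup>2 \<le> (real n - 1) * D\<^sup>2"
    by (simp add: D_def power2_eq_square algebra_simps)
  then have "1 / ((real n)\<^sup>2 * (real n - 1)) * (real n * (\<Sum>i<n. (x i)\<^sup>2) - S\<^sup>2)
      \<le> 1 / ((real n)\<^sup>2 * (real n - 1)) * ((real n - 1) * D\<^sup>2)"
    using n by (intro mult_left_mono) auto
  also have "\<dots> = (D / real n)\<^sup>2"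
    using n by (simp add: power_divide)
  finally have "sqrt (1 / ((real n)\<^sup>2 * (real n - 1)) * (real n * (\<Sum>i<n. (x i)\<^sup>2) - S\<^sup>2))
      \<le> D / real n"
    using D0 by (intro real_le_lsqrt) auto
  moreover have "D / real n = M - S / real n"
    using n by (simp add: D_def field_simps)
  ultimately show ?thesis by (simp add: S_def)
qed

text \<open>For positive \<open>k\<close> the root equals \<open>M / root k c\<close>, and the
  \<open>k\<close>-th root of a positive constant tends to 1.\<close>

lemma root_div_const_tendsto:
  fixes M c :: real
  assumes "M \<ge> 0" "c > 0"
  shows "(\<lambda>k. root k (M ^ k / c)) \<longlonglongrightarrow> M"
proof -
  have "(\<lambda>k. M / root k c) \<longlonglongrightarrow> M / 1"
    using assms by (intro tendsto_intros LIMSEQ_root_const) auto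
  moreover have "eventually (\<lambda>k. M / root k c = root k (M ^ k / c)) sequentially"
    using eventually_gt_at_top[of 0]
    by eventually_elim (use assms in \<open>simp add: real_root_divide real_root_power_cancel\<close>)
  ultimately show ?thesis
    by (auto intro: Lim_transform_eventually)
qed

section \<open>The bound and the squeeze\<close>

theorem theorem5p6:
  fixes G :: "'a pair_pre_digraph"
    and \<phi> :: "'a \<times> 'a \<Rightarrow> complex"
    and v :: "nat \<Rightarrow> 'a"
    and n :: nat
  assumes "unit_gain_graph G \<phi> v n"
    and "n \<ge> 2"
  shows "let L = gain_laplacian G \<phi> v n;
             Tr = (\<lambda>k. Re (mat_trace (L ^\<^sub>m k)));
             b = (\<lambda>k. root k (Tr k / real n
                   + sqrt (1 / ((real n)\<^sup>2 * (real n - 1)) * (real n * Tr (2 * k) - (Tr k)\<^sup>2))))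
         in (\<forall>k\<ge>1. largest_eigenvalue L \<ge> b k) \<and> b \<longlonglongrightarrow> largest_eigenvalue L"
proof -
  interpret unit_gain_graph G \<phi> v n by fact
  let ?L = "gain_laplacian G \<phi> v n"
  obtain d where ev: "{x. eigenvalue ?L (complex_of_real x)} = d ` {..<n}"
    and tr: "\<And>k. Re (mat_trace (?L ^\<^sub>m k)) = (\<Sum>i<n. d i ^ k)"
    using gain_laplacian_real_eigenvalues by metis
  define M where "M = largest_eigenvalue ?L"
  have M: "M = Max (d ` {..<n})"
    by (simp add: M_def largest_eigenvalue_def ev)
  have le: "d i \<le> M" if "i < n" for i
    unfolding M using that by (intro Max_ge) auto
  have "M \<in> d ` {..<n}"
    unfolding M using assms(2) by (intro Max_in) (auto simp: lessThan_empty_iff)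
  then obtain m where m: "m < n" "M = d m" by auto
  have nonneg: "d i \<ge> 0" if "i < n" for i
    using gain_laplacian_eigenvalue_nonneg that ev by blast
  have M0: "M \<ge> 0"
    using nonneg m by simp
  define c where "c k = (\<Sum>i<n. d i ^ k) / real n + sqrt (1 / ((real n)\<^sup>2 * (real n - 1))
    * (real n * (\<Sum>i<n. d i ^ (2 * k)) - (\<Sum>i<n. d i ^ k)\<^sup>2))" for k
  have upper: "root k (c k) \<le> M" if "k \<ge> 1" for k
  proof -
    \<comment> \<open>The inequality is applied to the \<open>k\<close>-th powers; nonnegativity of
      \<open>d i\<close> is what makes \<open>M ^ k\<close> an upper bound for them.\<close>
    have "c k \<le> M ^ k"
      using wolkowicz_styan[OF assms(2), of "\<lambda>i. d i ^ k" "M ^ k"] le nonneg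
      by (simp add: c_def power_mono mult.commute[of 2 k] flip: power_mult)
    then have "root k (c k) \<le> root k (M ^ k)"
      using that by simp
    also have "\<dots> = M"
      using that M0 by (simp add: real_root_power_cancel)
    finally show ?thesis .
  qed
  have lower: "root k (M ^ k / real n) \<le> root k (c k)" if "k \<ge> 1" for k
  proof -
    have "M ^ k \<le> (\<Sum>i<n. d i ^ k)"
      unfolding m(2) using m(1) nonneg by (intro member_le_sum) auto
    then have "M ^ k / real n \<le> (\<Sum>i<n. d i ^ k) / real n"
      by (simp add: divide_right_mono)
    \<comment> \<open>By Cauchy-Schwarz the radicand in \<open>c k\<close> is nonnegative. This is
      needed to drop the square root, as \<open>sqrt\<close> takes negative values at negative
      arguments.\<close>
    moreover have "(\<Sum>i<n. d i ^ k)\<^sup>2 \<le> real n * (\<Sum>i<n. d i ^ (2 * k))"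
      using sum_squared_le_sum_of_squares[of "\<lambda>i. d i ^ k" "{..<n}"]
      by (simp add: mult.commute[of 2 k] mult.commute[of "real n"] flip: power_mult)
    ultimately have "M ^ k / real n \<le> c k"
      using assms(2) by (simp add: c_def add_increasing2)
    then show ?thesis using that by simp
  qed
  have "(\<lambda>k. root k (c k)) \<longlonglongrightarrow> M"
  proof (rule tendsto_sandwich)
    show "(\<lambda>k. root k (M ^ k / real n)) \<longlonglongrightarrow> M"
      using M0 assms(2) by (intro root_div_const_tendsto) auto
    show "eventually (\<lambda>k. root k (M ^ k / real n) \<le> root k (c k)) sequentially"
      using eventually_ge_at_top[of 1] by eventually_elim (rule lower)
    show "eventually (\<lambda>k. root k (c k) \<le> M) sequentially"
      using eventually_ge_at_top[of 1] by eventually_elim (rule upper)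
  qed simp
  then show ?thesis
    using upper by (simp add: Let_def tr c_def M_def)
qed

end
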